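(* Let $\Gamma$ be an infinite locally finite connected graph, $F$ a field of characteristic $0$ with an arbitrary absolute value, and $\lambda$ an element of $F$ transcendental over the prime subfield $\mathbb{Q}$ of $F$. Then $\lambda$ is an eigenvalue of the adjacency operator $A_{\Gamma,\mathbb{Q}(\lambda)}$ (and hence also of the adjacency operator $A_{\Gamma,F}$).
   Context: A graph is an undirected graph without loops or multiple edges, with vertex set $V(\Gamma)$; $\Gamma(v)$ is the set of vertices adjacent to $v$. $\Gamma$ is locally finite if every $\Gamma(v)$ is finite. For a field $K$, $K^{V(\Gamma)}$ is the $K$-vector space of all functions $V(\Gamma)\to K$, and the adjacency operator $A_{\Gamma,K}:K^{V(\Gamma)}\to K^{V(\Gamma)}$ is the linear operator $(A_{\Gamma,K}(f))(v)=\sum_{u\in\Gamma(v)}f(u)$. An element $\lambda\in K$ is an eigenvalue of $A_{\Gamma,K}$ if there is a nonzero $f\in K^{V(\Gamma)}$ with $A_{\Gamma,K}(f)=\lambda f$ (no summability or finiteness condition on $f$). The notion of eigenvalue does not depend on the absolute value, which may be trivial. *)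

theory Defs
  imports Complex_Main "HOL-Library.FuncSet" "HOL-Computational_Algebra.Polynomial"
begin

text \<open>A graph is given by its vertex set \<open>V\<close> and its set \<open>E\<close> of undirected edges, each edge being
  the set of its two (distinct) end points.  Both sets may be infinite.\<close>

definition simple_graph :: "'v set \<Rightarrow> 'v set set \<Rightarrow> bool" where
  "simple_graph V E \<longleftrightarrow> (\<forall>e\<in>E. e \<subseteq> V \<and> card e = 2)"

definition neighbours :: "'v set set \<Rightarrow> 'v \<Rightarrow> 'v set" where
  "neighbours E v = {u. {u, v} \<in> E}"

definition locally_finite_graph :: "'v set \<Rightarrow> 'v set set \<Rightarrow> bool" where
  "locally_finite_graph V E \<longleftrightarrow> (\<forall>v\<in>V. finite (neighbours E v))"

definition connected_graph :: "'v set \<Rightarrow> 'v set set \<Rightarrow> bool" where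
  "connected_graph V E \<longleftrightarrow>
     V \<noteq> {} \<and> (\<forall>u\<in>V. \<forall>v\<in>V. (u, v) \<in> {(x, y). x \<in> neighbours E y}\<^sup>*)"

definition absolute_value :: "('a::field \<Rightarrow> real) \<Rightarrow> bool" where
  "absolute_value \<nu> \<longleftrightarrow>
     (\<forall>x. 0 \<le> \<nu> x) \<and> (\<forall>x. \<nu> x = 0 \<longleftrightarrow> x = 0) \<and>
     (\<forall>x y. \<nu> (x * y) = \<nu> x * \<nu> y) \<and> (\<forall>x y. \<nu> (x + y) \<le> \<nu> x + \<nu> y)"

definition is_subfield :: "'a::field set \<Rightarrow> bool" where
  "is_subfield K \<longleftrightarrow>
     0 \<in> K \<and> 1 \<in> K \<and> (\<forall>x\<in>K. \<forall>y\<in>K. x + y \<in> K \<and> x * y \<in> K) \<and>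
     (\<forall>x\<in>K. - x \<in> K \<and> inverse x \<in> K)"

definition rat_adjoin :: "'a::field_char_0 \<Rightarrow> 'a set" where
  "rat_adjoin a = \<Inter>{K. is_subfield K \<and> \<rat> \<subseteq> K \<and> a \<in> K}"

lemma is_subfield_UNIV: "is_subfield UNIV"
  by (simp add: is_subfield_def)

lemma is_subfield_rat_adjoin: "is_subfield (rat_adjoin a)"
  by (auto simp: is_subfield_def rat_adjoin_def)

lemma mem_rat_adjoin: "a \<in> rat_adjoin a"
  by (auto simp: rat_adjoin_def)

text \<open>The space of all functions from \<open>V\<close> to a subfield \<open>K\<close> of the ambient field is the set
  \<open>V \<rightarrow>\<^sub>E K\<close> of extensional functions, so that functions on \<open>V\<close> are equal iff they agree
  on \<open>V\<close>.  The operator over \<open>K\<close> is the restriction of \<open>adjacency_op\<close> to that space;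
  the sum is meaningful for locally finite graphs only.\<close>

definition adjacency_op :: "'v set \<Rightarrow> 'v set set \<Rightarrow> ('v \<Rightarrow> 'a::field) \<Rightarrow> ('v \<Rightarrow> 'a)" where
  "adjacency_op V E f = (\<lambda>v\<in>V. \<Sum>u\<in>neighbours E v. f u)"

definition adjacency_eigenvalue :: "'v set \<Rightarrow> 'v set set \<Rightarrow> 'a::field set \<Rightarrow> 'a \<Rightarrow> bool" where
  "adjacency_eigenvalue V E K c \<longleftrightarrow>
     c \<in> K \<and>
     (\<exists>f \<in> V \<rightarrow>\<^sub>E K. f \<noteq> (\<lambda>v\<in>V. 0) \<and> adjacency_op V E f = (\<lambda>v\<in>V. c * f v))"

lemma adjacency_op_closed:
  assumes "simple_graph V E" "is_subfield K" "f \<in> V \<rightarrow>\<^sub>E K"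
  shows "adjacency_op V E f \<in> V \<rightarrow>\<^sub>E K"
proof -
  have sum_in: "(\<Sum>u\<in>A. f u) \<in> K" if "A \<subseteq> V" for A
    using that
  proof (induction A rule: infinite_finite_induct)
    case (insert x A)
    then have "f x \<in> K" using assms(3) by (auto simp: PiE_def)
    then show ?case using insert assms(2) by (simp add: is_subfield_def)
  qed (use assms(2) in \<open>simp_all add: is_subfield_def\<close>)
  have "neighbours E v \<subseteq> V" for v
    using assms(1) by (auto simp: simple_graph_def neighbours_def)
  then show ?thesis
    by (auto simp: adjacency_op_def intro: sum_in)
qed

end

theory Submission
  imports Defs "HOL-Library.Function_Algebras" "HOL-Computational_Algebra.Fraction_Field"
begin

text \<open>The adjacency operator on all functions is the transpose of the adjacency operator on finitely
  supported functions.  Hence \<open>c\<close> is an eigenvalue over a field \<open>K\<close> as soon as some point mass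
  \<open>\<delta>\<^sub>v\<close> is not of the form \<open>A g - c g\<close> with \<open>g\<close> finitely supported: a linear functional that
  vanishes on the range of \<open>A - c\<close> and is \<open>1\<close> at \<open>\<delta>\<^sub>v\<close>, evaluated at the point masses, is an
  eigenfunction (\<open>eigenfunction_if_point_mass_not_in_range\<close>).

  Such a \<open>g\<close> is excluded by a maximum principle, which needs an order.  Since \<open>c\<close> is transcendental,
  \<open>\<rat>(c)\<close> is a copy of the field of fractions of \<open>\<int>[X]\<close>, which is an ordered field in which \<open>X\<close>
  exceeds every integer and thus every vertex degree.  If \<open>X h = A h + \<delta>\<^sub>v\<close> with \<open>h = -g\<close> finitely
  supported, then \<open>h\<close> has no negative minimum, so \<open>h \<ge> 0\<close>; moreover \<open>h\<close> is positive at \<open>v\<close>, and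
  positivity spreads along edges.  By connectedness \<open>h\<close> is positive on the whole infinite vertex
  set (\<open>no_finitely_supported_resolvent\<close>).  The resulting eigenfunction for \<open>X\<close> is
  carried to \<open>\<rat>(c)\<close> by the embedding \<open>X \<mapsto> c\<close>.\<close>

section \<open>The maximum principle\<close>

lemma neighbours_subset:
  assumes "simple_graph V E"
  shows "neighbours E v \<subseteq> V"
  using assms by (auto simp: simple_graph_def neighbours_def)

lemma neighbours_sym: "u \<in> neighbours E v \<longleftrightarrow> v \<in> neighbours E u"
  by (simp add: neighbours_def insert_commute)

text \<open>If \<open>h\<close> were negative somewhere, then at a vertex where it is minimal the sum over the
  neighbours would be at least the degree times the minimum, which exceeds \<open>t\<close> times the minimum.\<close>

lemma supersolution_nonneg:
  fixes t :: "'k::linordered_field"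
  assumes large: "\<And>n. of_nat n < t"
    and fin: "finite {u. h u \<noteq> 0}" and supp: "{u. h u \<noteq> 0} \<subseteq> V"
    and super: "\<And>w. w \<in> V \<Longrightarrow> (\<Sum>u\<in>neighbours E w. h u) \<le> t * h w"
  shows "0 \<le> h u"
proof (rule ccontr)
  assume "\<not> 0 \<le> h u"
  let ?N = "{u. h u < 0}"
  have "finite ?N" by (rule finite_subset[OF _ fin]) auto
  moreover have "?N \<noteq> {}" using \<open>\<not> 0 \<le> h u\<close> by (auto simp: not_le)
  ultimately obtain m where m: "m \<in> ?N" "\<And>w. w \<in> ?N \<Longrightarrow> h m \<le> h w"
    using arg_min_if_finite[of ?N h] by (metis not_less)
  have min: "h m \<le> h w" for w
    using m by (cases "h w < 0") auto
  have "m \<in> V" using m(1) supp by auto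
  have "of_nat (card (neighbours E m)) * h m \<le> (\<Sum>u\<in>neighbours E m. h u)"
    by (rule sum_bounded_below) (rule min)
  also have "\<dots> \<le> t * h m" by (rule super) fact
  finally have "of_nat (card (neighbours E m)) * h m \<le> t * h m" .
  moreover have "t * h m < of_nat (card (neighbours E m)) * h m"
    using m(1) large by (intro mult_strict_right_mono_neg) auto
  ultimately show False by simp
qed

lemma no_finitely_supported_resolvent:
  fixes t :: "'k::linordered_field"
  assumes graph: "simple_graph V E" and inf: "infinite V"
    and loc: "locally_finite_graph V E" and conn: "connected_graph V E"
    and large: "\<And>n. of_nat n < t"
    and fin: "finite {u. h u \<noteq> 0}" and supp: "{u. h u \<noteq> 0} \<subseteq> V"
    and v: "v \<in> V"
    and eq: "\<And>w. w \<in> V \<Longrightarrow> t * h w = (\<Sum>u\<in>neighbours E w. h u) + (if w = v then 1 else 0)"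
  shows False
proof -
  have "0 < t" using large[of 0] by simp
  have nonneg: "0 \<le> h u" for u
    by (rule supersolution_nonneg[OF large fin supp, of E]) (simp_all add: eq)
  have "0 \<le> (\<Sum>u\<in>neighbours E v. h u)" by (rule sum_nonneg) (rule nonneg)
  then have "0 < t * h v" using eq[OF v] by (simp add: add_nonneg_pos)
  then have pos_v: "0 < h v" using \<open>0 < t\<close> by (simp add: zero_less_mult_iff)
  have step: "0 < h y" if "0 < h x" "x \<in> neighbours E y" for x y
  proof -
    have "y \<in> V" using that(2)[THEN neighbours_sym[THEN iffD1]] neighbours_subset[OF graph] by blast
    then have "finite (neighbours E y)" using loc by (simp add: locally_finite_graph_def)
    then have "h x \<le> (\<Sum>u\<in>neighbours E y. h u)"
      using that(2) nonneg by (intro member_le_sum) auto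
    also have "\<dots> \<le> t * h y" using eq[OF \<open>y \<in> V\<close>] by simp
    finally have "0 < t * h y" using that(1) by simp
    then show ?thesis using \<open>0 < t\<close> by (simp add: zero_less_mult_iff)
  qed
  have "0 < h u" if "u \<in> V" for u
  proof -
    have "(v, u) \<in> {(x, y). x \<in> neighbours E y}\<^sup>*"
      using conn v that by (simp add: connected_graph_def)
    then show ?thesis
      by induction (use pos_v step in auto)
  qed
  then have "V \<subseteq> {u. h u \<noteq> 0}" by force
  then show False using fin inf finite_subset by blast
qed

section \<open>Duality\<close>

text \<open>The statement is about a field given as a type, so that the theory of vector spaces applies to
  the functions with values in it.  The functional is defined on all functions, but only its values at
  point masses matter.\<close>

lemma eigenfunction_if_point_mass_not_in_range:
  fixes V :: "'v set" and E :: "'v set set" and t :: "'k::field"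
  assumes loc: "locally_finite_graph V E" and v: "v \<in> V"
    and no_preimage: "\<And>g. finite {u. g u \<noteq> 0} \<Longrightarrow> {u. g u \<noteq> 0} \<subseteq> V \<Longrightarrow>
      (\<And>w. w \<in> V \<Longrightarrow> (\<Sum>u\<in>neighbours E w. g u) - t * g w = (if w = v then 1 else 0)) \<Longrightarrow> False"
  obtains f where "f v = 1" "\<And>w. w \<in> V \<Longrightarrow> (\<Sum>u\<in>neighbours E w. f u) = t * f w"
proof -
  let ?scale = "\<lambda>(a::'k) (x::'v \<Rightarrow> 'k) w. a * x w"
  interpret F: vector_space ?scale
    by standard (auto simp: algebra_simps fun_eq_iff)
  interpret P: vector_space_pair ?scale "(*) :: 'k \<Rightarrow> 'k \<Rightarrow> 'k"
    by standard (auto simp: algebra_simps)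
  define \<delta> :: "'v \<Rightarrow> 'v \<Rightarrow> 'k" where "\<delta> u w = (if w = u then 1 else 0)" for u w
  define T where "T w = (\<Sum>u\<in>neighbours E w. \<delta> u) - ?scale t (\<delta> w)" for w
  define R where "R = {x. \<exists>g. finite {u. g u \<noteq> 0} \<and> {u. g u \<noteq> 0} \<subseteq> V \<and>
    (\<forall>w\<in>V. x w = (\<Sum>u\<in>neighbours E w. g u) - t * g w)}"
  have finN: "finite (neighbours E w)" if "w \<in> V" for w
    using loc that by (simp add: locally_finite_graph_def)
  have "F.subspace R"
    unfolding F.subspace_def
  proof (intro conjI ballI allI)
    show "0 \<in> R" unfolding R_def by (auto intro!: exI[of _ "\<lambda>_. 0"])
  next
    fix x y assume "x \<in> R" "y \<in> R"
    then obtain g k where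
      g: "finite {u. g u \<noteq> 0}" "{u. g u \<noteq> 0} \<subseteq> V"
        "\<forall>w\<in>V. x w = (\<Sum>u\<in>neighbours E w. g u) - t * g w" and
      k: "finite {u. k u \<noteq> 0}" "{u. k u \<noteq> 0} \<subseteq> V"
        "\<forall>w\<in>V. y w = (\<Sum>u\<in>neighbours E w. k u) - t * k w"
      unfolding R_def by blast
    have sub: "{u. g u + k u \<noteq> 0} \<subseteq> {u. g u \<noteq> 0} \<union> {u. k u \<noteq> 0}" by auto
    have "finite {u. g u + k u \<noteq> 0}"
      using finite_subset[OF sub] g(1) k(1) by blast
    moreover have "{u. g u + k u \<noteq> 0} \<subseteq> V" using sub g(2) k(2) by blast
    moreover have "\<forall>w\<in>V. (x + y) w = (\<Sum>u\<in>neighbours E w. g u + k u) - t * (g w + k w)"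
      using g(3) k(3) by (simp add: sum.distrib algebra_simps)
    ultimately show "x + y \<in> R"
      unfolding R_def by (intro CollectI exI[of _ "\<lambda>u. g u + k u"] conjI)
  next
    fix a x assume "x \<in> R"
    then obtain g where
      g: "finite {u. g u \<noteq> 0}" "{u. g u \<noteq> 0} \<subseteq> V"
        "\<forall>w\<in>V. x w = (\<Sum>u\<in>neighbours E w. g u) - t * g w"
      unfolding R_def by blast
    have sub: "{u. a * g u \<noteq> 0} \<subseteq> {u. g u \<noteq> 0}" by auto
    have "finite {u. a * g u \<noteq> 0}" using finite_subset[OF sub] g(1) by blast
    moreover have "{u. a * g u \<noteq> 0} \<subseteq> V" using sub g(2) by blast
    moreover have "\<forall>w\<in>V. a * x w = (\<Sum>u\<in>neighbours E w. a * g u) - t * (a * g w)"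
      using g(3) by (simp add: sum_distrib_left[symmetric] right_diff_distrib mult.left_commute)
    ultimately show "?scale a x \<in> R"
      unfolding R_def by (intro CollectI exI[of _ "\<lambda>u. a * g u"] conjI)
  qed
  moreover have "T ` V \<subseteq> R"
  proof safe
    fix u assume u: "u \<in> V"
    have sum_\<delta>: "(\<Sum>x\<in>A. \<delta> x) w = (if w \<in> A then 1 else 0)" if "finite A" for A w
      using that by (induction A) (auto simp: \<delta>_def)
    have "T u w = (\<Sum>x\<in>neighbours E w. \<delta> u x) - t * \<delta> u w" if "w \<in> V" for w
    proof -
      have "(\<Sum>x\<in>neighbours E w. \<delta> u x) = (if u \<in> neighbours E w then 1 else 0)"
        using finN[OF that] by (simp add: \<delta>_def)
      then show ?thesis
        unfolding T_def by (simp add: sum_\<delta>[OF finN[OF u]] neighbours_sym[of w E u] \<delta>_def)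
    qed
    moreover have "{x. \<delta> u x \<noteq> 0} = {u}" by (auto simp: \<delta>_def)
    ultimately show "T u \<in> R" using u unfolding R_def by (intro CollectI exI[of _ "\<delta> u"]) simp
  qed
  ultimately have span: "F.span (T ` V) \<subseteq> R" by (rule F.span_minimal[rotated])
  have "\<delta> v \<notin> R"
  proof
    assume "\<delta> v \<in> R"
    then obtain g where g: "finite {u. g u \<noteq> 0}" "{u. g u \<noteq> 0} \<subseteq> V"
      "\<forall>w\<in>V. \<delta> v w = (\<Sum>u\<in>neighbours E w. g u) - t * g w"
      unfolding R_def by blast
    show False by (rule no_preimage[OF g(1,2)]) (simp add: g(3)[rule_format, symmetric] \<delta>_def[symmetric])
  qed
  obtain B where B: "B \<subseteq> T ` V" "F.independent B" "T ` V \<subseteq> F.span B"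
    by (rule F.maximal_independent_subset)
  have "\<delta> v \<notin> F.span B" using \<open>\<delta> v \<notin> R\<close> span F.span_mono[OF B(1)] by blast
  then have ind: "F.independent (insert (\<delta> v) B)" and notB: "\<delta> v \<notin> B"
    using B(2) F.independent_insertI F.span_base by blast+
  obtain \<phi> where lin: "Vector_Spaces.linear ?scale (*) \<phi>"
    and \<phi>: "\<forall>x\<in>insert (\<delta> v) B. \<phi> x = (if x = \<delta> v then 1 else 0)"
    using P.linear_independent_extend[OF ind, of "\<lambda>x. if x = \<delta> v then 1 else 0"] by blast
  interpret \<phi>: Vector_Spaces.linear ?scale "(*)" \<phi> by (rule lin)
  have "\<phi> x = 0" if "x \<in> F.span B" for x
    using that \<phi> notB by (intro \<phi>.eq_0_on_span[OF _ that]) auto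
  then have kill: "\<phi> (T w) = 0" if "w \<in> V" for w using B(3) that by blast
  show thesis
  proof
    show "\<phi> (\<delta> v) = 1" using \<phi> by simp
    show "(\<Sum>u\<in>neighbours E w. \<phi> (\<delta> u)) = t * \<phi> (\<delta> w)" if "w \<in> V" for w
      using kill[OF that] unfolding T_def \<phi>.diff \<phi>.sum \<phi>.scale by simp
  qed
qed

lemma infinitely_large_eigenvalue:
  fixes t :: "'k::linordered_field"
  assumes graph: "simple_graph V E" and inf: "infinite V"
    and loc: "locally_finite_graph V E" and conn: "connected_graph V E"
    and large: "\<And>n. of_nat n < t"
  obtains f v where "v \<in> V" "f v = 1" "\<And>w. w \<in> V \<Longrightarrow> (\<Sum>u\<in>neighbours E w. f u) = t * f w"
proof -
  obtain v where v: "v \<in> V" using conn by (auto simp: connected_graph_def)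
  show thesis
  proof (rule eigenfunction_if_point_mass_not_in_range[OF loc v])
    fix g
    assume g: "finite {u. g u \<noteq> 0}" "{u. g u \<noteq> 0} \<subseteq> V"
      "\<And>w. w \<in> V \<Longrightarrow> (\<Sum>u\<in>neighbours E w. g u) - t * g w = (if w = v then 1 else 0)"
    show False
    proof (rule no_finitely_supported_resolvent[OF graph inf loc conn large _ _ v])
      show "finite {u. - g u \<noteq> 0}" "{u. - g u \<noteq> 0} \<subseteq> V" using g(1,2) by auto
      show "t * - g w = (\<Sum>u\<in>neighbours E w. - g u) + (if w = v then 1 else 0)" if "w \<in> V" for w
        using g(3)[OF that] by (auto simp: sum_negf algebra_simps split: if_splits)
    qed
  next
    fix f
    assume "f v = 1" "\<And>w. w \<in> V \<Longrightarrow> (\<Sum>u\<in>neighbours E w. f u) = t * f w"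
    with v show thesis by (rule that)
  qed
qed

section \<open>Rational functions and their values at a transcendental element\<close>

abbreviation rat_fun_X :: "int poly fract" where
  "rat_fun_X \<equiv> Fract [:0, 1:] 1"

text \<open>Polynomials over an ordered ring are ordered by the sign of the leading coefficient.\<close>

lemma of_nat_less_rat_fun_X: "of_nat n < rat_fun_X"
  by (simp add: of_nat_fract less_poly_def pos_poly_def of_nat_poly)

definition int_poly_value :: "'a::field_char_0 \<Rightarrow> int poly \<Rightarrow> 'a" where
  "int_poly_value c p = poly (map_poly of_int p) c"

lemma int_poly_value_pCons [simp]:
  "int_poly_value c (pCons a p) = of_int a + c * int_poly_value c p"
  by (simp add: int_poly_value_def map_poly_pCons)

lemma int_poly_value_0 [simp]: "int_poly_value c 0 = 0"
  by (simp add: int_poly_value_def)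

lemma int_poly_value_1 [simp]: "int_poly_value c 1 = 1"
  by (simp add: one_pCons)

lemma int_poly_value_add [simp]:
  "int_poly_value c (p + q) = int_poly_value c p + int_poly_value c q"
  by (induction p q rule: poly_induct2) (simp_all add: algebra_simps)

lemma int_poly_value_smult [simp]:
  "int_poly_value c (smult a p) = of_int a * int_poly_value c p"
  by (induction p) (simp_all add: algebra_simps)

lemma int_poly_value_mult [simp]:
  "int_poly_value c (p * q) = int_poly_value c p * int_poly_value c q"
  by (induction p) (simp_all add: algebra_simps)

lemma int_poly_value_eq_0_iff:
  assumes "\<not> algebraic c"
  shows "int_poly_value c p = 0 \<longleftrightarrow> p = 0"
proof
  assume "int_poly_value c p = 0"
  then show "p = 0"
    using assms algebraicI[of "map_poly of_int p" c]
    by (auto simp: int_poly_value_def coeff_map_poly map_poly_eq_0_iff)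
qed simp

lemma int_poly_value_in_rat_adjoin: "int_poly_value c p \<in> rat_adjoin c"
proof (induction p)
  case 0
  then show ?case using is_subfield_rat_adjoin by (auto simp: is_subfield_def)
next
  case (pCons a p)
  have "of_int a \<in> rat_adjoin c" by (auto simp: rat_adjoin_def)
  then show ?case
    using is_subfield_rat_adjoin[of c] mem_rat_adjoin[of c] pCons by (simp add: is_subfield_def)
qed

text \<open>The choice of a representative makes this a total definition for every \<open>c\<close>; it is independent
  of the representative only when \<open>c\<close> is transcendental.\<close>

definition rat_fun_value :: "'a::field_char_0 \<Rightarrow> int poly fract \<Rightarrow> 'a" where
  "rat_fun_value c x =
     (case SOME (p, q). q \<noteq> 0 \<and> x = Fract p q of (p, q) \<Rightarrow> int_poly_value c p / int_poly_value c q)"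

context
  fixes c :: "'a::field_char_0"
  assumes transcendental: "\<not> algebraic c"
begin

lemma rat_fun_value_Fract:
  assumes "q \<noteq> 0"
  shows "rat_fun_value c (Fract p q) = int_poly_value c p / int_poly_value c q"
proof -
  let ?P = "\<lambda>(p', q'). q' \<noteq> 0 \<and> Fract p q = Fract p' q'"
  obtain p' q' where some: "Eps ?P = (p', q')" by fastforce
  have "?P (Eps ?P)" by (rule someI[of ?P "(p, q)"]) (simp add: assms)
  then have *: "q' \<noteq> 0" "Fract p q = Fract p' q'" unfolding some by auto
  then have "p * q' = p' * q" using assms by (simp add: eq_fract)
  then have "int_poly_value c p * int_poly_value c q' = int_poly_value c p' * int_poly_value c q"
    by (metis int_poly_value_mult)
  then show ?thesis
    unfolding rat_fun_value_def some
    using assms *(1) by (simp add: frac_eq_eq int_poly_value_eq_0_iff[OF transcendental])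
qed

lemma rat_fun_value_0: "rat_fun_value c 0 = 0"
  by (simp add: Zero_fract_def rat_fun_value_Fract)

lemma rat_fun_value_1: "rat_fun_value c 1 = 1"
  by (simp add: One_fract_def rat_fun_value_Fract)

lemma rat_fun_value_X: "rat_fun_value c rat_fun_X = c"
  by (simp add: rat_fun_value_Fract)

lemma rat_fun_value_add: "rat_fun_value c (x + y) = rat_fun_value c x + rat_fun_value c y"
  by (cases x; cases y)
    (simp add: rat_fun_value_Fract add_frac_eq int_poly_value_eq_0_iff[OF transcendental])

lemma rat_fun_value_mult: "rat_fun_value c (x * y) = rat_fun_value c x * rat_fun_value c y"
  by (cases x; cases y) (simp add: rat_fun_value_Fract)

lemma rat_fun_value_sum: "rat_fun_value c (\<Sum>i\<in>I. f i) = (\<Sum>i\<in>I. rat_fun_value c (f i))"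
  by (induction I rule: infinite_finite_induct) (simp_all add: rat_fun_value_0 rat_fun_value_add)

lemma rat_fun_value_in_rat_adjoin: "rat_fun_value c x \<in> rat_adjoin c"
  using is_subfield_rat_adjoin[of c] int_poly_value_in_rat_adjoin[of c]
  by (cases x) (simp add: rat_fun_value_Fract is_subfield_def divide_inverse)

end

section \<open>Transcendental eigenvalues\<close>

theorem mainTheorem7:
  fixes V :: "'v set" and E :: "'v set set"
    and \<nu> :: "'a::field_char_0 \<Rightarrow> real" and c :: 'a
  assumes "simple_graph V E"
    and "infinite V"
    and "locally_finite_graph V E"
    and "connected_graph V E"
    and "absolute_value \<nu>"
    and "\<not> algebraic c"
  shows "adjacency_eigenvalue V E (rat_adjoin c) c
       \<and> adjacency_eigenvalue V E (UNIV :: 'a set) c"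
proof -
  obtain f v where f: "v \<in> V" "f v = 1"
    "\<And>w. w \<in> V \<Longrightarrow> (\<Sum>u\<in>neighbours E w. f u) = rat_fun_X * f w"
    using infinitely_large_eigenvalue[OF assms(1-4) of_nat_less_rat_fun_X] by metis
  define g where "g = (\<lambda>w\<in>V. rat_fun_value c (f w))"
  have g_in: "g \<in> V \<rightarrow>\<^sub>E rat_adjoin c"
    unfolding g_def using rat_fun_value_in_rat_adjoin[OF assms(6)] by auto
  have "g v = 1" using f(1,2) by (simp add: g_def rat_fun_value_1[OF assms(6)])
  then have g_nz: "g \<noteq> (\<lambda>v\<in>V. 0)" using f(1) by auto
  have "adjacency_op V E g = (\<lambda>w\<in>V. c * g w)"
    unfolding adjacency_op_def
  proof (rule restrict_ext)
    fix w assume w: "w \<in> V"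
    have "(\<Sum>u\<in>neighbours E w. g u) = (\<Sum>u\<in>neighbours E w. rat_fun_value c (f u))"
      using neighbours_subset[OF assms(1)] by (intro sum.cong) (auto simp: g_def)
    also have "\<dots> = rat_fun_value c (rat_fun_X * f w)"
      by (simp only: rat_fun_value_sum[OF assms(6), symmetric] f(3)[OF w])
    also have "\<dots> = c * g w"
      using w by (simp only: rat_fun_value_mult[OF assms(6)] rat_fun_value_X[OF assms(6)])
        (simp add: g_def)
    finally show "(\<Sum>u\<in>neighbours E w. g u) = c * g w" .
  qed
  moreover have "g \<in> V \<rightarrow>\<^sub>E UNIV" using g_in by auto
  ultimately show ?thesis
    unfolding adjacency_eigenvalue_def using g_in g_nz mem_rat_adjoin[of c] by blast
qed

end
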